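(* Let $\Bbbk$ be a field, $B$ a finite set, $\deg\colon B\to\mathbb Z^m$ a function, and $P$ a poset structure on $B$ such that $\deg\colon P\to\mathbb Z^m$ is a morphism of posets, such that $\dim_\Bbbk\widetilde H_{d_P(a)-1}(\Delta(P_{<a});\Bbbk)=1$ for each $a\in B$, and such that $\widetilde{\mathcal C}_\bullet(P_{\deg\le\alpha},\Bbbk)$ is exact for every $\alpha\in\mathbb Z^m$ with $P_{\deg\le\alpha}$ nonempty. Then there exists an hcw-poset structure $Q$ over $\Bbbk$ on the set $B$ such that: (1) $\mathrm{id}_B\colon P\to Q$ and $\deg\colon Q\to\mathbb Z^m$ are morphisms of posets; (2) $\dim\Delta(P_{\le a})=\dim\Delta(Q_{\le a})$ for every $a\in B$; (3) $\widetilde{\mathcal C}_\bullet(P,\Bbbk)=\widetilde{\mathcal C}_\bullet(Q,\Bbbk)$ as subcomplexes of the augmented simplicial chain complex of $\Delta(Q)$.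
   Context: For a finite poset $P$ and $a\in P$: $P_{\le a},P_{<a}$ the sets of elements $\le a$, resp. $<a$; $\Delta(S)$ the order complex; $d_P(a)=\dim\Delta(P_{\le a})$; faces oriented by listing vertices in decreasing order. A finite poset $Q$ is a homology CW-poset (hcw-poset) over $\Bbbk$ if for every $a\in Q$, $\widetilde H_i(\Delta(Q_{<a});\Bbbk)\cong\Bbbk$ for $i=\dim\Delta(Q_{<a})$ and $=0$ for all other $i$ (the empty complex has dimension $-1$ and $\widetilde H_{-1}=\Bbbk$). Conic chain complex: $\mathcal C_n(P,\Bbbk)=H_n(\Delta^n,\Delta^{n-1};\Bbbk)$ where $\Delta^n=\Delta(\{a:d(a)\le n\})$, identified with the subspace of simplicial $n$-chains of $\Delta(P)$ spanned by chains $[c,z]$ with $d(c)=n$ and $z$ an $(n-1)$-cycle of $\Delta(P_{<c})$ ($[c,\cdot]$ prepends vertex $c$ linearly), with simplicial boundary as differential; the augmented version $\widetilde{\mathcal C}_\bullet(P,\Bbbk)$ adds $\mathcal C_{-1}=\Bbbk\cdot[\,]$ with $\partial_0[c]=[\,]$. $P_{\deg\le\alpha}=\{x:\deg x\le\alpha\}$ with the induced order. *)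

theory Defs
  imports Main
begin

definition poset_on :: "'a set \<Rightarrow> ('a \<Rightarrow> 'a \<Rightarrow> bool) \<Rightarrow> bool" where
  "poset_on B le \<longleftrightarrow> (\<forall>x\<in>B. le x x)
     \<and> (\<forall>x\<in>B. \<forall>y\<in>B. le x y \<and> le y x \<longrightarrow> x = y)
     \<and> (\<forall>x\<in>B. \<forall>y\<in>B. \<forall>z\<in>B. le x y \<and> le y z \<longrightarrow> le x z)"

definition lt_of :: "('a \<Rightarrow> 'a \<Rightarrow> bool) \<Rightarrow> 'a \<Rightarrow> 'a \<Rightarrow> bool" where
  "lt_of le x y \<longleftrightarrow> le x y \<and> x \<noteq> y"

definition below_eq :: "('a \<Rightarrow> 'a \<Rightarrow> bool) \<Rightarrow> 'a set \<Rightarrow> 'a \<Rightarrow> 'a set" where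
  "below_eq le S a = {x\<in>S. le x a}"

definition below :: "('a \<Rightarrow> 'a \<Rightarrow> bool) \<Rightarrow> 'a set \<Rightarrow> 'a \<Rightarrow> 'a set" where
  "below le S a = {x\<in>S. lt_of le x a}"

text \<open>Faces of the order complex of S: chains listed in strictly decreasing order
  (the empty list is the empty face, of dimension -1).\<close>
definition simplex :: "('a \<Rightarrow> 'a \<Rightarrow> bool) \<Rightarrow> 'a set \<Rightarrow> 'a list \<Rightarrow> bool" where
  "simplex le S \<sigma> \<longleftrightarrow> set \<sigma> \<subseteq> S \<and> sorted_wrt (\<lambda>x y. lt_of le y x) \<sigma>"

text \<open>Dimension of the order complex (the empty complex has dimension -1).\<close>
definition ocdim :: "('a \<Rightarrow> 'a \<Rightarrow> bool) \<Rightarrow> 'a set \<Rightarrow> int" where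
  "ocdim le S = int (Max (length ` {\<sigma>. simplex le S \<sigma>})) - 1"

text \<open>Simplicial chains of the order complex of S with n vertices (dimension n-1),
  coefficients in 'k.\<close>
definition chains :: "('a \<Rightarrow> 'a \<Rightarrow> bool) \<Rightarrow> 'a set \<Rightarrow> nat \<Rightarrow> ('a list \<Rightarrow> 'k::zero) set" where
  "chains le S n = {c. \<forall>\<sigma>. c \<sigma> \<noteq> 0 \<longrightarrow> simplex le S \<sigma> \<and> length \<sigma> = n}"

text \<open>Simplicial boundary: the coefficient of tau in the boundary of c is the sum over
  all ways of inserting a vertex x at position j of tau, with sign (-1)^j.\<close>
definition bd :: "'a set \<Rightarrow> ('a list \<Rightarrow> 'k::comm_ring_1) \<Rightarrow> 'a list \<Rightarrow> 'k" where
  "bd S c \<tau> = (\<Sum>j\<le>length \<tau>. \<Sum>x\<in>S. (-1)^j * c (take j \<tau> @ x # drop j \<tau>))"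

definition cycles :: "('a \<Rightarrow> 'a \<Rightarrow> bool) \<Rightarrow> 'a set \<Rightarrow> nat \<Rightarrow> ('a list \<Rightarrow> 'k::comm_ring_1) set" where
  "cycles le S n = {c \<in> chains le S n. bd S c = (\<lambda>_. 0)}"

definition boundaries :: "('a \<Rightarrow> 'a \<Rightarrow> bool) \<Rightarrow> 'a set \<Rightarrow> nat \<Rightarrow> ('a list \<Rightarrow> 'k::comm_ring_1) set" where
  "boundaries le S n = bd S ` chains le S (Suc n)"

text \<open>Reduced homology in degree n-1 (augmented chain complex) is isomorphic to k,
  i.e. one-dimensional over k.\<close>
definition hom_is_field :: "'k::field itself \<Rightarrow> ('a \<Rightarrow> 'a \<Rightarrow> bool) \<Rightarrow> 'a set \<Rightarrow> nat \<Rightarrow> bool" where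
  "hom_is_field K le S n \<longleftrightarrow>
     (\<exists>z \<in> (cycles le S n :: ('a list \<Rightarrow> 'k) set). z \<notin> boundaries le S n \<and>
        (\<forall>w \<in> cycles le S n. \<exists>t. (\<lambda>\<sigma>. w \<sigma> - t * z \<sigma>) \<in> boundaries le S n))"

definition hom_vanishes :: "'k::field itself \<Rightarrow> ('a \<Rightarrow> 'a \<Rightarrow> bool) \<Rightarrow> 'a set \<Rightarrow> nat \<Rightarrow> bool" where
  "hom_vanishes K le S n \<longleftrightarrow>
     (cycles le S n :: ('a list \<Rightarrow> 'k) set) \<subseteq> boundaries le S n"

text \<open>hcw-poset over k (degrees below -1 have trivially vanishing reduced homology).\<close>
definition hcw :: "'k::field itself \<Rightarrow> ('a \<Rightarrow> 'a \<Rightarrow> bool) \<Rightarrow> 'a set \<Rightarrow> bool" where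
  "hcw K le Q \<longleftrightarrow> poset_on Q le \<and>
     (\<forall>a\<in>Q. \<forall>n::nat.
        (int n - 1 = ocdim le (below le Q a) \<longrightarrow> hom_is_field K le (below le Q a) n) \<and>
        (int n - 1 \<noteq> ocdim le (below le Q a) \<longrightarrow> hom_vanishes K le (below le Q a) n))"

definition cone :: "'a \<Rightarrow> ('a list \<Rightarrow> 'k::zero) \<Rightarrow> 'a list \<Rightarrow> 'k" where
  "cone c z \<sigma> = (case \<sigma> of [] \<Rightarrow> 0 | x # \<tau> \<Rightarrow> if x = c then z \<tau> else 0)"

inductive_set fspan :: "('b \<Rightarrow> 'k::comm_ring_1) set \<Rightarrow> ('b \<Rightarrow> 'k) set" for G where
  zero: "(\<lambda>_. 0) \<in> fspan G"
| add: "v \<in> fspan G \<Longrightarrow> g \<in> G \<Longrightarrow> (\<lambda>\<sigma>. v \<sigma> + t * g \<sigma>) \<in> fspan G"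

text \<open>Augmented conic chain complex of the poset (S, le); index L = number of vertices,
  i.e. L = n+1 for C_n, and L = 0 for C_{-1} = k[].\<close>
definition conic :: "'k::field itself \<Rightarrow> ('a \<Rightarrow> 'a \<Rightarrow> bool) \<Rightarrow> 'a set \<Rightarrow> nat \<Rightarrow> ('a list \<Rightarrow> 'k) set" where
  "conic K le S L = (if L = 0 then chains le S 0 else
     fspan {cone c z | c z. c \<in> S \<and> ocdim le (below_eq le S c) = int L - 1
                           \<and> z \<in> cycles le (below le S c) (L - 1)})"

definition exact_conic :: "'k::field itself \<Rightarrow> ('a \<Rightarrow> 'a \<Rightarrow> bool) \<Rightarrow> 'a set \<Rightarrow> bool" where
  "exact_conic K le S \<longleftrightarrow>
     (\<forall>L. {c \<in> conic K le S L. bd S c = (\<lambda>_. 0)} = bd S ` conic K le S (Suc L))"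

text \<open>deg : B -> Z^m, with Z^m encoded as nat => int (components i < m), ordered componentwise.\<close>
definition deg_mono :: "nat \<Rightarrow> ('a \<Rightarrow> nat \<Rightarrow> int) \<Rightarrow> ('a \<Rightarrow> 'a \<Rightarrow> bool) \<Rightarrow> 'a set \<Rightarrow> bool" where
  "deg_mono m deg le B \<longleftrightarrow> (\<forall>x\<in>B. \<forall>y\<in>B. le x y \<longrightarrow> (\<forall>i<m. deg x i \<le> deg y i))"

definition deg_sub :: "nat \<Rightarrow> ('a \<Rightarrow> nat \<Rightarrow> int) \<Rightarrow> 'a set \<Rightarrow> (nat \<Rightarrow> int) \<Rightarrow> 'a set" where
  "deg_sub m deg B \<alpha> = {x\<in>B. \<forall>i<m. deg x i \<le> \<alpha> i}"

end

(* Let z_a span the top cycles of P_{<a}; the cones [a, z_a] form a basis of the conic complex, with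
   boundaries z_a.  Enlarge P by letting b < a whenever deg b <= deg a and either d(b) < d(a) - 1, or
   d(b) = d(a) - 1 and b lies in a set J_a.  Transitivity is automatic because d drops.  J_a is a
   maximal set, containing the b <_P a with d(b) = d(a) - 1, on which the only linear relation among
   the z_b is the one coming from z_a.  By maximality the z_b with b in J_a span all z_b with
   deg b <= deg a, d(b) = d(a) - 1.  Uniqueness of the relation makes z_a span the top cycles of
   Q_{<a}; spanning, together with exactness at deg a and cellular approximation, kills the lower
   homology of Q_{<a}. *)
theory Submission
  imports Defs
begin

text \<open>Two demands on Q_{<a} conflict: filling low cycles asks for many elements below a,
  keeping the top cycles down to the multiples of z_a asks for few. The conflict concerns rank
  d(a)-1 only. Simplices with d(a) vertices must start there, so a top cycle is a sum of [c,u_c]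
  over c of that rank, with u_c a top cycle of Q_{<c}, by induction a multiple of z_c. Hence the top
  cycles of Q_{<a} are the sums of t_c [c,z_c] over J_a whose boundary, the sum of t_c z_c,
  vanishes. They are compared with z_a itself, and not merely counted, because the conic complex has
  to stay the same. Inside P_{<a} they are multiples of z_a already, so the enlargement can start
  from P. In the other direction, exactness at deg a may fill a cycle by cones over elements outside
  J_a; only the boundary of the filling matters, and it can be rewritten with the z_b for b in
  J_a.\<close>

section \<open>Chains, boundaries and cones\<close>

lemma chainsI:
  "(\<And>\<sigma>. c \<sigma> \<noteq> 0 \<Longrightarrow> simplex le S \<sigma> \<and> length \<sigma> = n) \<Longrightarrow> c \<in> chains le S n"
  by (simp add: chains_def)

lemma chainsD:
  assumes "c \<in> chains le S n" "c \<sigma> \<noteq> 0"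
  shows "simplex le S \<sigma>" "length \<sigma> = n"
  using assms unfolding chains_def by blast+

lemma chains_0_cong: "w \<in> chains le S 0 \<Longrightarrow> w \<in> chains le' T 0"
  by (rule chainsI) (drule (1) chainsD(2), simp add: simplex_def)

lemma bd_Nil: "bd S w [] = (\<Sum>x\<in>S. w [x])"
  by (simp add: bd_def)

text \<open>Separates insertion in front of \<open>y\<close> from insertion behind it, where every
  position and hence every sign shifts by one. This recursion replaces index computations with
  \<open>take\<close> and \<open>drop\<close>.\<close>

lemma bd_Cons: "bd S w (y # \<tau>) = (\<Sum>x\<in>S. w (x # y # \<tau>)) - bd S (\<lambda>\<sigma>. w (y # \<sigma>)) \<tau>"
  unfolding bd_def by (simp add: sum.atMost_Suc_shift sum_negf del: sum.atMost_Suc)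

text \<open>Inserting a vertex outside \<open>S\<close> never gives a simplex of \<open>S\<close>.
  All boundaries can therefore be taken in one ambient set, although \<open>cycles\<close> and
  \<open>boundaries\<close> refer to varying ones.\<close>

lemma bd_superset:
  assumes "c \<in> chains le S n" "S \<subseteq> T" "finite T"
  shows "bd S c = bd T c"
proof
  fix \<tau>
  have "(\<Sum>x\<in>S. (-1)^j * c (take j \<tau> @ x # drop j \<tau>)) = (\<Sum>x\<in>T. (-1)^j * c (take j \<tau> @ x # drop j \<tau>))" for j
  proof (rule sum.mono_neutral_left)
    show "\<forall>x\<in>T - S. (-1)^j * c (take j \<tau> @ x # drop j \<tau>) = 0"
    proof
      fix x assume x: "x \<in> T - S"
      then have "\<not> simplex le S (take j \<tau> @ x # drop j \<tau>)"
        by (auto simp: simplex_def)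
      then have "c (take j \<tau> @ x # drop j \<tau>) = 0"
        using assms(1) unfolding chains_def by blast
      then show "(-1)^j * c (take j \<tau> @ x # drop j \<tau>) = 0"
        by simp
    qed
  qed (use assms in auto)
  then show "bd S c \<tau> = bd T c \<tau>"
    by (simp add: bd_def)
qed

lemma bd_lincomb:
  "bd S (\<lambda>\<sigma>. \<Sum>i\<in>I. t i * f i \<sigma>) \<tau> = (\<Sum>i\<in>I. t i * bd S (f i) \<tau>)"
proof -
  have "bd S (\<lambda>\<sigma>. \<Sum>i\<in>I. t i * f i \<sigma>) \<tau>
      = (\<Sum>j\<le>length \<tau>. \<Sum>x\<in>S. \<Sum>i\<in>I. t i * ((-1)^j * f i (take j \<tau> @ x # drop j \<tau>)))"
    by (simp add: bd_def sum_distrib_left algebra_simps)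
  also have "\<dots> = (\<Sum>j\<le>length \<tau>. \<Sum>i\<in>I. \<Sum>x\<in>S. t i * ((-1)^j * f i (take j \<tau> @ x # drop j \<tau>)))"
    by (rule sum.cong[OF refl], rule sum.swap)
  also have "\<dots> = (\<Sum>i\<in>I. \<Sum>j\<le>length \<tau>. \<Sum>x\<in>S. t i * ((-1)^j * f i (take j \<tau> @ x # drop j \<tau>)))"
    by (rule sum.swap)
  finally show ?thesis
    by (simp add: bd_def sum_distrib_left)
qed

lemma bd_sum: "bd S (\<lambda>\<sigma>. \<Sum>i\<in>I. f i \<sigma>) \<tau> = (\<Sum>i\<in>I. bd S (f i) \<tau>)"
  using bd_lincomb[of S "\<lambda>_. 1" f I \<tau>] by simp

lemma bd_add: "bd S (\<lambda>\<sigma>. f \<sigma> + g \<sigma>) \<tau> = bd S f \<tau> + bd S g \<tau>"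
  by (simp add: bd_def sum.distrib algebra_simps)

lemma bd_diff: "bd S (\<lambda>\<sigma>. f \<sigma> - g \<sigma>) \<tau> = bd S f \<tau> - bd S g \<tau>"
  by (simp add: bd_def sum_subtractf algebra_simps)

lemma bd_scale: "bd S (\<lambda>\<sigma>. t * f \<sigma>) \<tau> = t * bd S f \<tau>"
  by (simp add: bd_def sum_distrib_left algebra_simps)

lemma bd_zero: "bd S (\<lambda>_. 0) = (\<lambda>_. 0)"
  by (simp add: bd_def fun_eq_iff)

lemma cone_simps [simp]:
  "cone c z [] = 0" "cone c z (x # \<tau>) = (if x = c then z \<tau> else 0)"
  by (simp_all add: cone_def)

text \<open>The cone formula d[c,z] = z - [c,dz], valid for any coefficient function
  \<open>z\<close>, so no support condition has to be checked first.\<close>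

lemma bd_cone:
  assumes "finite S" "c \<in> S"
  shows "bd S (cone c z) \<tau> = z \<tau> - cone c (bd S z) \<tau>"
proof (cases \<tau>)
  case Nil
  then show ?thesis using assms by (simp add: bd_Nil)
next
  case (Cons y \<tau>')
  have "bd S (\<lambda>\<sigma>. cone c z (y # \<sigma>)) \<tau>' = (if y = c then bd S z \<tau>' else 0)"
    by (simp add: bd_zero)
  then show ?thesis using assms Cons by (simp add: bd_Cons del: cone_simps(2)) simp
qed

lemma simplex_mono:
  assumes "simplex le S \<sigma>" "S \<subseteq> T" "\<And>x y. x \<in> S \<Longrightarrow> y \<in> S \<Longrightarrow> le x y \<Longrightarrow> le' x y"
  shows "simplex le' T \<sigma>"
proof -
  have "sorted_wrt (\<lambda>x y. lt_of le' y x) \<sigma>"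
    by (rule sorted_wrt_mono_rel[of _ "\<lambda>x y. lt_of le y x"])
      (use assms in \<open>auto simp: simplex_def lt_of_def\<close>)
  then show ?thesis using assms(1,2) by (auto simp: simplex_def)
qed

lemma chains_mono:
  assumes "w \<in> chains le S n" "S \<subseteq> T" "\<And>x y. x \<in> S \<Longrightarrow> y \<in> S \<Longrightarrow> le x y \<Longrightarrow> le' x y"
  shows "w \<in> chains le' T n"
proof (rule chainsI)
  fix \<sigma> assume "w \<sigma> \<noteq> 0"
  note \<sigma> = chainsD[OF assms(1) this]
  show "simplex le' T \<sigma> \<and> length \<sigma> = n"
    using simplex_mono[OF \<sigma>(1) assms(2,3)] \<sigma>(2) by simp
qed

lemma chains_lincomb:
  fixes f :: "'i \<Rightarrow> 'a list \<Rightarrow> 'k::comm_ring_1"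
  assumes "\<And>i. i \<in> I \<Longrightarrow> f i \<in> chains le S n"
  shows "(\<lambda>\<sigma>. \<Sum>i\<in>I. t i * f i \<sigma>) \<in> chains le S n"
proof (rule chainsI)
  fix \<sigma> assume nz: "(\<Sum>i\<in>I. t i * f i \<sigma>) \<noteq> 0"
  obtain i where "i \<in> I" "f i \<sigma> \<noteq> 0"
  proof (rule ccontr)
    assume "\<not> thesis"
    then have "\<forall>i\<in>I. f i \<sigma> = 0" using that by blast
    then show False using nz by simp
  qed
  then show "simplex le S \<sigma> \<and> length \<sigma> = n" using assms chainsD by blast
qed

lemma chains_sum:
  fixes f :: "'i \<Rightarrow> 'a list \<Rightarrow> 'k::comm_ring_1"
  assumes "\<And>i. i \<in> I \<Longrightarrow> f i \<in> chains le S n"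
  shows "(\<lambda>\<sigma>. \<Sum>i\<in>I. f i \<sigma>) \<in> chains le S n"
  using chains_lincomb[of I f le S n "\<lambda>_. 1"] assms by simp

lemma chains_diff:
  fixes f g :: "'a list \<Rightarrow> 'k::comm_ring_1"
  assumes "f \<in> chains le S n" "g \<in> chains le S n"
  shows "(\<lambda>\<sigma>. f \<sigma> - g \<sigma>) \<in> chains le S n"
proof (rule chainsI)
  fix \<sigma> assume "f \<sigma> - g \<sigma> \<noteq> 0"
  then have "f \<sigma> \<noteq> 0 \<or> g \<sigma> \<noteq> 0" by auto
  then show "simplex le S \<sigma> \<and> length \<sigma> = n" using assms chainsD by blast
qed

lemma chains_add:
  fixes f g :: "'a list \<Rightarrow> 'k::comm_ring_1"
  assumes "f \<in> chains le S n" "g \<in> chains le S n"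
  shows "(\<lambda>\<sigma>. f \<sigma> + g \<sigma>) \<in> chains le S n"
proof (rule chainsI)
  fix \<sigma> assume "f \<sigma> + g \<sigma> \<noteq> 0"
  then have "f \<sigma> \<noteq> 0 \<or> g \<sigma> \<noteq> 0" by auto
  then show "simplex le S \<sigma> \<and> length \<sigma> = n" using assms chainsD by blast
qed

lemma chains_scale:
  fixes f :: "'a list \<Rightarrow> 'k::comm_ring_1"
  shows "f \<in> chains le S n \<Longrightarrow> (\<lambda>\<sigma>. t * f \<sigma>) \<in> chains le S n"
proof (rule chainsI)
  assume f: "f \<in> chains le S n"
  fix \<sigma> assume "t * f \<sigma> \<noteq> 0"
  then have "f \<sigma> \<noteq> 0" by auto
  then show "simplex le S \<sigma> \<and> length \<sigma> = n" using f chainsD by blast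
qed

lemma chains_zero: "(\<lambda>_. 0) \<in> chains le S n"
  by (simp add: chains_def)

lemma cone_chains:
  assumes "z \<in> chains le (below le T c) n" "c \<in> S" "below le T c \<subseteq> S"
  shows "cone c z \<in> chains le S (Suc n)"
proof (rule chainsI)
  fix \<sigma> assume "cone c z \<sigma> \<noteq> 0"
  then obtain \<tau> where \<tau>: "\<sigma> = c # \<tau>" "z \<tau> \<noteq> 0"
    by (cases \<sigma>) (auto split: if_splits)
  from chainsD[OF assms(1) \<tau>(2)] have "simplex le (below le T c) \<tau>" "length \<tau> = n" .
  then show "simplex le S \<sigma> \<and> length \<sigma> = Suc n"
    using assms(2,3) by (auto simp: \<tau>(1) simplex_def below_def)
qed

lemma link_chains:
  assumes "w \<in> chains le S (Suc n)"
  shows "(\<lambda>\<tau>. w (c # \<tau>)) \<in> chains le (below le S c) n"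
proof (rule chainsI)
  fix \<tau> assume "w (c # \<tau>) \<noteq> 0"
  from chainsD[OF assms this] show "simplex le (below le S c) \<tau> \<and> length \<tau> = n"
    by (auto simp: simplex_def below_def)
qed

lemma chain_eq_sum_cones:
  fixes w :: "'a list \<Rightarrow> 'k::comm_ring_1"
  assumes "w \<in> chains le S (Suc n)" "finite S"
  shows "w \<sigma> = (\<Sum>c\<in>S. cone c (\<lambda>\<tau>. w (c # \<tau>)) \<sigma>)"
proof (cases \<sigma>)
  case Nil
  then show ?thesis using chainsD(2)[OF assms(1), of "[]"] by auto
next
  case (Cons x \<tau>)
  moreover have "w (x # \<tau>) = 0" if "x \<notin> S"
    using chainsD(1)[OF assms(1), of "x # \<tau>"] that by (auto simp: simplex_def)
  ultimately show ?thesis using assms(2) by simp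
qed

lemma cycles_iff:
  assumes "S \<subseteq> T" "finite T"
  shows "c \<in> cycles le S n \<longleftrightarrow> c \<in> chains le S n \<and> bd T c = (\<lambda>_. 0)"
  using bd_superset[of c le S n T] assms unfolding cycles_def by auto

lemma boundaries_iff:
  assumes "S \<subseteq> T" "finite T"
  shows "c \<in> boundaries le S n \<longleftrightarrow> (\<exists>u\<in>chains le S (Suc n). c = bd T u)"
  using bd_superset[of _ le S "Suc n" T] assms unfolding boundaries_def by auto

lemma zero_boundaries: "(\<lambda>_. 0) \<in> boundaries le S n"
  unfolding boundaries_def
  by (rule image_eqI[of _ _ "\<lambda>_. 0"], rule bd_zero[symmetric], rule chains_zero)

section \<open>Linear algebra behind the choice of J\<close>

text \<open>Maximality of \<open>J\<close>: a bad relation on \<open>insert c J\<close> involves \<open>z c\<close>, which then lies in the span.\<close>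
lemma extend_with_controlled_relations:
  fixes z :: "'c \<Rightarrow> 'b \<Rightarrow> 'k::field" and y :: "'c \<Rightarrow> 'd \<Rightarrow> 'k" and x :: "'d \<Rightarrow> 'k"
  defines "good \<equiv> \<lambda>J. \<forall>t. (\<forall>\<sigma>. (\<Sum>c\<in>J. t c * z c \<sigma>) = 0)
      \<longrightarrow> (\<exists>s. \<forall>\<sigma>. (\<Sum>c\<in>J. t c * y c \<sigma>) = s * x \<sigma>)"
  assumes "finite A" "I \<subseteq> A" "good I"
  shows "\<exists>J. I \<subseteq> J \<and> J \<subseteq> A \<and> good J \<and> (\<forall>c\<in>A. \<exists>s. \<forall>\<sigma>. z c \<sigma> = (\<Sum>b\<in>J. s b * z b \<sigma>))"
proof -
  have fin: "finite {J. I \<subseteq> J \<and> J \<subseteq> A \<and> good J}"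
    using assms(2) by simp
  have I: "I \<in> {J. I \<subseteq> J \<and> J \<subseteq> A \<and> good J}"
    using assms(3,4) by simp
  from finite_has_maximal2[OF fin I] obtain J where
    "J \<in> {J. I \<subseteq> J \<and> J \<subseteq> A \<and> good J}"
    and max: "\<forall>J'\<in>{J. I \<subseteq> J \<and> J \<subseteq> A \<and> good J}. J \<subseteq> J' \<longrightarrow> J = J'" by auto
  then have J: "I \<subseteq> J" "J \<subseteq> A" "good J" by simp_all
  have finJ: "finite J" using J(2) assms(2) finite_subset by blast
  have "\<exists>s. \<forall>\<sigma>. z c \<sigma> = (\<Sum>b\<in>J. s b * z b \<sigma>)" if c: "c \<in> A" for c
  proof (cases "c \<in> J")
    case True
    have "z c \<sigma> = (\<Sum>b\<in>J. (if b = c then 1 else 0) * z b \<sigma>)" for \<sigma>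
      using True finJ by (simp add: if_distrib[where f="\<lambda>x. x * _"] cong: if_cong)
    then show ?thesis by (intro exI[of _ "\<lambda>b. if b = c then 1 else 0"] allI)
  next
    case False
    have "\<not> good (insert c J)"
    proof
      assume "good (insert c J)"
      then have "J = insert c J"
        using bspec[OF max, of "insert c J"] J(1,2) c by auto
      then show False using False by auto
    qed
    then obtain t where "\<forall>\<sigma>. (\<Sum>b\<in>insert c J. t b * z b \<sigma>) = 0"
      and "\<not> (\<exists>s. \<forall>\<sigma>. (\<Sum>b\<in>insert c J. t b * y b \<sigma>) = s * x \<sigma>)"
      unfolding good_def by meson
    then have t: "\<And>\<sigma>. t c * z c \<sigma> + (\<Sum>b\<in>J. t b * z b \<sigma>) = 0"
      and bad: "\<not> (\<exists>s. \<forall>\<sigma>. t c * y c \<sigma> + (\<Sum>b\<in>J. t b * y b \<sigma>) = s * x \<sigma>)"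
      using False finJ by simp_all
    \<comment> \<open>Otherwise the relation would live on \<open>J\<close>, where
      \<open>good J\<close> supplies exactly the scalar that \<open>bad\<close> excludes.\<close>
    have "t c \<noteq> 0"
    proof
      assume "t c = 0"
      then have "\<forall>\<sigma>. (\<Sum>b\<in>J. t b * z b \<sigma>) = 0" using t by simp
      then have "\<exists>s. \<forall>\<sigma>. (\<Sum>b\<in>J. t b * y b \<sigma>) = s * x \<sigma>"
        using J(3) unfolding good_def by blast
      then show False using bad \<open>t c = 0\<close> by simp
    qed
    then have "z c \<sigma> = (\<Sum>b\<in>J. (- t b / t c) * z b \<sigma>)" for \<sigma>
    proof -
      have "t c * z c \<sigma> = - (\<Sum>b\<in>J. t b * z b \<sigma>)"
        using t[of \<sigma>] by (simp add: eq_neg_iff_add_eq_0)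
      then have "z c \<sigma> = - (\<Sum>b\<in>J. t b * z b \<sigma>) / t c"
        using \<open>t c \<noteq> 0\<close> by (simp add: field_simps)
      then show ?thesis
        by (simp add: sum_negf sum_divide_distrib)
    qed
    then show ?thesis by (intro exI[of _ "\<lambda>b. - t b / t c"] allI)
  qed
  then show ?thesis using J by blast
qed

lemma span_trans:
  fixes z :: "'c \<Rightarrow> 'b \<Rightarrow> 'k::comm_ring_1"
  assumes "\<And>c. c \<in> A \<Longrightarrow> \<exists>s. \<forall>\<sigma>. z c \<sigma> = (\<Sum>b\<in>J. s b * z b \<sigma>)"
  shows "\<exists>s. \<forall>\<sigma>. (\<Sum>c\<in>A. t c * z c \<sigma>) = (\<Sum>b\<in>J. s b * z b \<sigma>)"
proof -
  have "\<forall>c\<in>A. \<exists>s. \<forall>\<sigma>. z c \<sigma> = (\<Sum>b\<in>J. s b * z b \<sigma>)" using assms by blast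
  from bchoice[OF this] obtain s where
    s: "\<forall>c\<in>A. \<forall>\<sigma>. z c \<sigma> = (\<Sum>b\<in>J. s c b * z b \<sigma>)" by blast
  have "(\<Sum>c\<in>A. t c * z c \<sigma>) = (\<Sum>b\<in>J. (\<Sum>c\<in>A. t c * s c b) * z b \<sigma>)" for \<sigma>
  proof -
    have "(\<Sum>c\<in>A. t c * z c \<sigma>) = (\<Sum>c\<in>A. t c * (\<Sum>b\<in>J. s c b * z b \<sigma>))"
      by (rule sum.cong[OF refl]) (use s in \<open>blast intro: arg_cong[where f="\<lambda>x. _ * x"]\<close>)
    also have "\<dots> = (\<Sum>c\<in>A. \<Sum>b\<in>J. t c * s c b * z b \<sigma>)"
      by (simp add: sum_distrib_left mult.assoc)
    also have "\<dots> = (\<Sum>b\<in>J. \<Sum>c\<in>A. t c * s c b * z b \<sigma>)"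
      by (rule sum.swap)
    finally show ?thesis by (simp add: sum_distrib_right)
  qed
  then show ?thesis by (intro exI[of _ "\<lambda>b. \<Sum>c\<in>A. t c * s c b"] allI)
qed

section \<open>Posets with a strictly increasing rank\<close>

locale ranked_poset =
  fixes B :: "'a set" and le :: "'a \<Rightarrow> 'a \<Rightarrow> bool" and r :: "'a \<Rightarrow> nat"
  assumes finB: "finite B"
    and poset: "poset_on B le"
    and rank_less: "\<And>x y. x \<in> B \<Longrightarrow> y \<in> B \<Longrightarrow> lt_of le x y \<Longrightarrow> r x < r y"
begin

lemma length_tail_le_rank: "simplex le B (x # \<tau>) \<Longrightarrow> length \<tau> \<le> r x"
proof (induction \<tau> arbitrary: x)
  case (Cons y \<tau>)
  then have "length \<tau> \<le> r y" "r y < r x"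
    using rank_less by (auto simp: simplex_def)
  then show ?case by simp
qed simp

lemma simplex_length_le:
  assumes "simplex le S \<sigma>" "S \<subseteq> B" "\<And>x. x \<in> S \<Longrightarrow> r x < n"
  shows "length \<sigma> \<le> n"
proof (cases \<sigma>)
  case (Cons x \<tau>)
  then have "length \<tau> \<le> r x" "r x < n"
    using assms length_tail_le_rank[of x \<tau>] by (auto simp: simplex_def)
  then show ?thesis using Cons by simp
qed simp

lemma below_lower: "c \<in> B \<Longrightarrow> x \<in> below le B c \<Longrightarrow> x \<in> B \<and> r x < r c"
  using rank_less by (auto simp: below_def)

lemma below_trans:
  assumes "a \<in> B" "c \<in> below le B a"
  shows "below le B c \<subseteq> below le B a"
  using assms poset unfolding below_def lt_of_def poset_on_def by blast

lemma chains_above_rank: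
  assumes "w \<in> chains le S n" "S \<subseteq> B" "\<And>x. x \<in> S \<Longrightarrow> r x < k" "k < n"
  shows "w = (\<lambda>_. 0)"
proof -
  have False if "w \<sigma> \<noteq> 0" for \<sigma>
    using simplex_length_le[OF chainsD(1)[OF assms(1) that] assms(2,3)]
      chainsD(2)[OF assms(1) that] assms(4) by simp
  then show ?thesis by blast
qed

text \<open>With all ranks below \<open>n\<close> there are no simplices with \<open>Suc n\<close>
  vertices. Thus homology in the top degree is the space of cycles itself.\<close>

lemma boundaries_above_rank:
  assumes "u \<in> boundaries le S n" "S \<subseteq> B" "\<And>x. x \<in> S \<Longrightarrow> r x < n"
  shows "u = (\<lambda>_. 0 :: 'k::comm_ring_1)"
proof -
  obtain v where v: "v \<in> chains le S (Suc n)" "u = bd S v"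
    using assms(1) unfolding boundaries_def by blast
  have "v = (\<lambda>_. 0)"
    by (rule chains_above_rank[OF v(1) assms(2,3)]) simp_all
  then show ?thesis using v(2) by (simp add: bd_zero)
qed

text \<open>No vertex of the support lies above \<open>c\<close>, since \<open>c\<close> has the
  largest rank allowed. In the recursion for the boundary at \<open>c # \<tau>\<close> the front
  insertions vanish, and what is left is minus the boundary of the link.\<close>

lemma top_link_cycle:
  fixes w :: "'a list \<Rightarrow> 'k::comm_ring_1"
  assumes w: "w \<in> chains le {x\<in>X. r x < Suc j} (Suc n)" "bd B w = (\<lambda>_. 0)"
    and X: "X \<subseteq> B" and c: "c \<in> X" "r c = j"
  shows "(\<lambda>\<tau>. w (c # \<tau>)) \<in> cycles le (below le B c) n"
proof -
  have 1: "(\<lambda>\<tau>. w (c # \<tau>)) \<in> chains le (below le B c) n"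
    by (rule chains_mono[OF link_chains[OF w(1)]]) (use X in \<open>auto simp: below_def\<close>)
  have "w (x # c # \<tau>) = 0" for x \<tau>
  proof (rule ccontr)
    assume "w (x # c # \<tau>) \<noteq> 0"
    from chainsD(1)[OF w(1) this] have "x \<in> X" "r x < Suc j" "lt_of le c x"
      by (auto simp: simplex_def)
    then show False using rank_less[of c x] X c by auto
  qed
  then have "bd B (\<lambda>\<tau>. w (c # \<tau>)) = (\<lambda>_. 0)"
    using bd_Cons[of B w c] w(2) by (simp add: fun_eq_iff)
  moreover have "below le B c \<subseteq> B" by (auto simp: below_def)
  ultimately show ?thesis
    using 1 cycles_iff[OF _ finB] by blast
qed

text \<open>\<open>Suc n\<close> strictly decreasing ranks below \<open>Suc n\<close> must be n,
  ..., 0, so each simplex of the support starts in rank \<open>n\<close>.\<close>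

lemma top_chain_eq_sum_cones:
  fixes w :: "'a list \<Rightarrow> 'k::comm_ring_1"
  assumes w: "w \<in> chains le {x\<in>X. r x < Suc n} (Suc n)" and X: "X \<subseteq> B"
  shows "w \<sigma> = (\<Sum>c\<in>{x\<in>X. r x = n}. cone c (\<lambda>\<tau>. w (c # \<tau>)) \<sigma>)"
proof -
  have fin: "finite {x\<in>X. r x < Suc n}"
    using X finB by (simp add: finite_subset)
  have "cone c (\<lambda>\<tau>. w (c # \<tau>)) \<sigma> = 0" if "c \<in> X" "r c < n" for c
  proof (cases \<sigma>)
    case (Cons x \<tau>)
    have "w (c # \<tau>) = 0"
    proof (rule ccontr)
      assume "w (c # \<tau>) \<noteq> 0"
      then have "simplex le B (c # \<tau>)" "length \<tau> = n"
        using chainsD[OF w, of "c # \<tau>"] X by (auto simp: simplex_def)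
      then show False using length_tail_le_rank that by fastforce
    qed
    then show ?thesis using Cons by simp
  qed simp
  then show ?thesis
    unfolding chain_eq_sum_cones[OF w fin, of \<sigma>]
    by (intro sum.mono_neutral_right fin) (auto simp: less_Suc_eq)
qed

end

section \<open>The conic complex in terms of the cycles z\<close>

lemma fspan_lincomb:
  assumes "finite I" "\<And>i. i \<in> I \<Longrightarrow> g i \<in> G"
  shows "(\<lambda>\<sigma>. \<Sum>i\<in>I. t i * g i \<sigma>) \<in> fspan G"
  using assms
proof (induction I rule: finite_induct)
  case empty
  then show ?case using fspan.zero by simp
next
  case (insert i I)
  then have "(\<lambda>\<sigma>. (\<Sum>i\<in>I. t i * g i \<sigma>) + t i * g i \<sigma>) \<in> fspan G"
    by (intro fspan.add) auto
  then show ?case using insert by (simp add: add.commute)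
qed

text \<open>Chains are indexed by their number of vertices, so \<open>r c\<close> is the index for
  dimension d(c)-1. As there are no boundaries in that degree, one-dimensional homology amounts to
  \<open>top_cycles\<close> together with \<open>z c\<close> being nonzero.\<close>

locale cyclic_poset = ranked_poset B le r for B :: "'a set" and le r +
  fixes z :: "'a \<Rightarrow> 'a list \<Rightarrow> 'k::field"
  assumes rank: "\<And>c. c \<in> B \<Longrightarrow> ocdim le (below_eq le B c) = int (r c)"
    and top_cycles: "\<And>c w. c \<in> B \<Longrightarrow>
      w \<in> cycles le (below le B c) (r c) \<longleftrightarrow> (\<exists>t. w = (\<lambda>\<sigma>. t * z c \<sigma>))"
begin

lemma z_cycle:
  assumes "c \<in> B"
  shows "z c \<in> chains le (below le B c) (r c)" "bd B (z c) = (\<lambda>_. 0)"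
proof -
  have "z c \<in> cycles le (below le B c) (r c)"
    using top_cycles[OF assms, of "z c"] by (metis mult_1)
  moreover have "below le B c \<subseteq> B" by (auto simp: below_def)
  ultimately show "z c \<in> chains le (below le B c) (r c)" "bd B (z c) = (\<lambda>_. 0)"
    using cycles_iff[OF _ finB] by blast+
qed

lemma bd_cone_z:
  assumes "c \<in> B"
  shows "bd B (cone c (z c)) = z c"
proof
  fix \<sigma>
  have "cone c (\<lambda>_. 0 :: 'k) \<sigma> = 0" by (cases \<sigma>) auto
  then show "bd B (cone c (z c)) \<sigma> = z c \<sigma>"
    using bd_cone[OF finB assms, of "z c" \<sigma>] z_cycle(2)[OF assms] by simp
qed

lemma bd_lincomb_cone_z:
  assumes "I \<subseteq> B"
  shows "bd B (\<lambda>\<sigma>. \<Sum>c\<in>I. t c * cone c (z c) \<sigma>) \<sigma> = (\<Sum>c\<in>I. t c * z c \<sigma>)"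
  unfolding bd_lincomb using assms bd_cone_z by (intro sum.cong) auto

lemma lower_below:
  assumes "S \<subseteq> B" "\<And>c. c \<in> S \<Longrightarrow> below le B c \<subseteq> S" "c \<in> S"
  shows "below le S c = below le B c" "below_eq le S c = below_eq le B c"
  using assms unfolding below_def below_eq_def lt_of_def by blast+

text \<open>A generator [c,u] has \<open>u\<close> a multiple of \<open>z c\<close>, so one cone for
  each element of rank \<open>n\<close> suffices. Down-closedness of \<open>S\<close> makes ranks
  and top cycles in \<open>S\<close> agree with those in \<open>B\<close>.\<close>

lemma conic_Suc:
  assumes S: "S \<subseteq> B" "\<And>c. c \<in> S \<Longrightarrow> below le B c \<subseteq> S"
  shows "w \<in> conic TYPE('k) le S (Suc n)
    \<longleftrightarrow> (\<exists>t. w = (\<lambda>\<sigma>. \<Sum>c\<in>{c\<in>S. r c = n}. t c * cone c (z c) \<sigma>))"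
    (is "_ \<longleftrightarrow> (\<exists>t. w = ?f t)")
proof -
  have fin: "finite {c\<in>S. r c = n}" using S(1) finB by (simp add: finite_subset)
  have conic: "conic TYPE('k) le S (Suc n)
      = fspan {cone c u |c u. c \<in> S \<and> r c = n \<and> u \<in> cycles le (below le B c) n}"
  proof -
    have "c \<in> S \<and> ocdim le (below_eq le S c) = int (Suc n) - 1 \<and> u \<in> cycles le (below le S c) (Suc n - 1)
      \<longleftrightarrow> c \<in> S \<and> r c = n \<and> u \<in> cycles le (below le B c) n" for c and u :: "'a list \<Rightarrow> 'k"
      using lower_below[OF S] rank[of c] S(1) by auto
    then show ?thesis unfolding conic_def by simp
  qed
  have "\<exists>t. v = ?f t"
    if "v \<in> fspan {cone c u |c u. c \<in> S \<and> r c = n \<and> u \<in> cycles le (below le B c) n}" for v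
    using that
  proof induction
    case zero
    then show ?case by (intro exI[of _ "\<lambda>_. 0"]) simp
  next
    case (add v g a)
    then obtain t c u where t: "v = ?f t" and g: "g = cone c u"
      and c: "c \<in> S" "r c = n" and u: "u \<in> cycles le (below le B c) n" by blast
    obtain s where s: "u = (\<lambda>\<sigma>. s * z c \<sigma>)"
      using u c top_cycles[of c u] S(1) by blast
    have g': "g \<sigma> = s * cone c (z c) \<sigma>" for \<sigma>
      by (cases \<sigma>) (auto simp: g s)
    have "v \<sigma> + a * g \<sigma> = ?f (\<lambda>b. t b + (if b = c then a * s else 0)) \<sigma>" for \<sigma>
    proof -
      have "(\<Sum>b\<in>{c\<in>S. r c = n}. (if b = c then a * s else 0) * cone b (z b) \<sigma>)
          = a * g \<sigma>"
        using c fin by (simp add: if_distrib[where f="\<lambda>x. x * _"] g' cong: if_cong)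
      then show ?thesis by (simp add: t distrib_right sum.distrib)
    qed
    then show ?case by (intro exI[of _ "\<lambda>b. t b + (if b = c then a * s else 0)"]) auto
  qed
  moreover have "?f t \<in> fspan {cone c u |c u. c \<in> S \<and> r c = n \<and> u \<in> cycles le (below le B c) n}" for t
  proof (rule fspan_lincomb[OF fin])
    fix c assume c: "c \<in> {c\<in>S. r c = n}"
    have "z c = (\<lambda>\<sigma>. 1 * z c \<sigma>)" by simp
    then have "z c \<in> cycles le (below le B c) n"
      using c S(1) top_cycles[of c "z c"] by blast
    then show "cone c (z c) \<in> {cone c u |c u. c \<in> S \<and> r c = n \<and> u \<in> cycles le (below le B c) n}"
      using c by blast
  qed
  ultimately show ?thesis unfolding conic by blast
qed

lemma conic_chains:
  assumes S: "S \<subseteq> B" "\<And>c. c \<in> S \<Longrightarrow> below le B c \<subseteq> S"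
    and w: "w \<in> conic TYPE('k) le S n"
  shows "w \<in> chains le S n"
proof (cases n)
  case 0
  then show ?thesis using w by (simp add: conic_def)
next
  case (Suc k)
  then obtain t where t: "w = (\<lambda>\<sigma>. \<Sum>c\<in>{c\<in>S. r c = k}. t c * cone c (z c) \<sigma>)"
    using w conic_Suc[OF S] by blast
  have "cone c (z c) \<in> chains le S n" if "c \<in> {c\<in>S. r c = k}" for c
    using that z_cycle(1)[of c] cone_chains[of "z c" le B c k S] S Suc by auto
  then show ?thesis unfolding t by (rule chains_lincomb)
qed

text \<open>Exactness writes \<open>w\<close> as the boundary of a combination of cones [b,z_b], and
  each such cone has boundary z_b. For \<open>n = 0\<close> this is exactness at the
  augmentation.\<close>

lemma conic_cycle_eq_lincomb:
  assumes S: "S \<subseteq> B" "\<And>c. c \<in> S \<Longrightarrow> below le B c \<subseteq> S"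
    and exact: "exact_conic TYPE('k) le S"
    and w: "w \<in> conic TYPE('k) le S n" "bd B w = (\<lambda>_. 0)"
  shows "\<exists>s. \<forall>\<sigma>. w \<sigma> = (\<Sum>b\<in>{b\<in>S. r b = n}. s b * z b \<sigma>)"
proof -
  have "bd S w = (\<lambda>_. 0)"
    using bd_superset[OF conic_chains[OF S w(1)] S(1) finB] w(2) by simp
  then obtain v where v: "v \<in> conic TYPE('k) le S (Suc n)" "w = bd S v"
    using exact w(1) unfolding exact_conic_def by blast
  then obtain s where s: "v = (\<lambda>\<sigma>. \<Sum>c\<in>{c\<in>S. r c = n}. s c * cone c (z c) \<sigma>)"
    using conic_Suc[OF S] by blast
  have "w = bd B v"
    using bd_superset[OF conic_chains[OF S v(1)] S(1) finB] v(2) by simp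
  moreover have "bd B v \<sigma> = (\<Sum>b\<in>{b\<in>S. r b = n}. s b * z b \<sigma>)" for \<sigma>
    unfolding s by (rule bd_lincomb_cone_z) (use S in auto)
  ultimately show ?thesis by auto
qed

end

section \<open>The enlarged order\<close>

text \<open>\<open>S a\<close> abstracts the set of elements of degree at most deg a.
  \<open>J_relations\<close> bounds \<open>J a\<close> from above, allowing no new top cycle;
  \<open>J_span\<close> bounds it from below, so that fillings survive; \<open>J_below\<close>
  retains the old order.\<close>

locale thickening = cyclic_poset B le r z
  for B :: "'a set" and le r and z :: "'a \<Rightarrow> 'a list \<Rightarrow> 'k::field" +
  fixes S J :: "'a \<Rightarrow> 'a set"
  assumes S_sub: "\<And>a. a \<in> B \<Longrightarrow> S a \<subseteq> B"
    and S_trans: "\<And>a b. a \<in> B \<Longrightarrow> b \<in> S a \<Longrightarrow> S b \<subseteq> S a"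
    and below_S: "\<And>a. a \<in> B \<Longrightarrow> below le B a \<subseteq> S a"
    and exact_S: "\<And>a. a \<in> B \<Longrightarrow> exact_conic TYPE('k) le (S a)"
    and J_sub: "\<And>a. a \<in> B \<Longrightarrow> J a \<subseteq> {c\<in>S a. Suc (r c) = r a}"
    and J_below: "\<And>a. a \<in> B \<Longrightarrow> {c\<in>below le B a. Suc (r c) = r a} \<subseteq> J a"
    and J_relations: "\<And>a t. a \<in> B \<Longrightarrow> \<forall>\<sigma>. (\<Sum>c\<in>J a. t c * z c \<sigma>) = 0
      \<Longrightarrow> \<exists>s. \<forall>\<sigma>. (\<Sum>c\<in>J a. t c * cone c (z c) \<sigma>) = s * z a \<sigma>"
    and J_span: "\<And>a c. a \<in> B \<Longrightarrow> c \<in> S a \<Longrightarrow> Suc (r c) = r a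
      \<Longrightarrow> \<exists>s. \<forall>\<sigma>. z c \<sigma> = (\<Sum>b\<in>J a. s b * z b \<sigma>)"
begin

definition W :: "'a \<Rightarrow> 'a set" where
  "W a = {b\<in>S a. Suc (r b) < r a} \<union> J a"

definition leQ :: "'a \<Rightarrow> 'a \<Rightarrow> bool" where
  "leQ x y \<longleftrightarrow> x = y \<or> x \<in> W y"

lemma W_S: "a \<in> B \<Longrightarrow> x \<in> W a \<Longrightarrow> x \<in> S a \<and> r x < r a"
  using J_sub by (fastforce simp: W_def)

lemma W_sub: "a \<in> B \<Longrightarrow> W a \<subseteq> B"
  using W_S S_sub by blast

lemma W_trans:
  assumes "a \<in> B" "c \<in> W a" shows "W c \<subseteq> W a"
proof
  fix x assume "x \<in> W c"
  then show "x \<in> W a"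
    using W_S[of a c] W_S[of c x] S_trans[of a c] W_sub[of a] assms by (auto simp: W_def)
qed

lemma below_leQ: "a \<in> B \<Longrightarrow> below leQ B a = W a"
  using W_S[of a] W_sub[of a] by (auto simp: below_def lt_of_def leQ_def)

lemma le_leQ:
  assumes "x \<in> B" "y \<in> B" "le x y"
  shows "leQ x y"
proof (cases "x = y")
  case False
  then have "x \<in> below le B y" "r x < r y"
    using assms rank_less by (auto simp: below_def lt_of_def)
  then show ?thesis
    using below_S J_below assms by (fastforce simp: leQ_def W_def)
qed (simp add: leQ_def)

lemma W_eq_J: "a \<in> B \<Longrightarrow> r a = Suc n \<Longrightarrow> {x\<in>W a. r x = n} = J a"
  using J_sub[of a] by (auto simp: W_def)

sublocale Q: ranked_poset B leQ r
proof
  show "finite B" by (rule finB)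
  show "r x < r y" if "x \<in> B" "y \<in> B" "lt_of leQ x y" for x y
    using that W_S by (auto simp: lt_of_def leQ_def)
  show "poset_on B leQ"
    unfolding poset_on_def
  proof (intro conjI ballI impI)
    fix x y assume *: "x \<in> B" "y \<in> B" "leQ x y \<and> leQ y x"
    show "x = y"
      using * W_S[of x y] W_S[of y x] by (auto simp: leQ_def)
  next
    fix x y u assume *: "x \<in> B" "y \<in> B" "u \<in> B" "leQ x y \<and> leQ y u"
    then show "leQ x u"
      using W_trans[of u y] by (auto simp: leQ_def)
  qed (simp add: leQ_def)
qed

lemma chains_le_leQ: "w \<in> chains le T n \<Longrightarrow> T \<subseteq> T' \<Longrightarrow> T \<subseteq> B \<Longrightarrow> w \<in> chains leQ T' n"
  by (erule chains_mono) (auto intro: le_leQ)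

lemma below_W: "a \<in> B \<Longrightarrow> below le B a \<subseteq> W a"
  using le_leQ below_leQ[of a] by (auto simp: below_def lt_of_def)

lemma z_chain_leQ: "a \<in> B \<Longrightarrow> z a \<in> chains leQ (W a) (r a)"
  by (rule chains_le_leQ[OF z_cycle(1) below_W]) (auto simp: below_def)

text \<open>The links of the rank \<open>n\<close> vertices are top cycles of their down-sets. Their
  description is the hypothesis \<open>tc\<close>, so that the lemma serves both inside the
  induction that proves this description and after it.\<close>

lemma expand_in_cones:
  assumes X: "X \<subseteq> B"
    and w: "w \<in> chains leQ {x\<in>X. r x < Suc n} (Suc n)" "bd B w = (\<lambda>_. 0)"
    and tc: "\<And>c u. c \<in> X \<Longrightarrow> r c = n \<Longrightarrow> u \<in> cycles leQ (W c) n \<Longrightarrow> \<exists>t. u = (\<lambda>\<sigma>. t * z c \<sigma>)"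
  shows "\<exists>t. w = (\<lambda>\<sigma>. \<Sum>c\<in>{x\<in>X. r x = n}. t c * cone c (z c) \<sigma>)"
proof -
  have "\<exists>t. (\<lambda>\<tau>. w (c # \<tau>)) = (\<lambda>\<sigma>. t * z c \<sigma>)" if "c \<in> X" "r c = n" for c
    using tc[OF that] Q.top_link_cycle[OF w X that] below_leQ[of c] that X by auto
  then obtain t where t: "\<And>c. c \<in> X \<Longrightarrow> r c = n \<Longrightarrow> (\<lambda>\<tau>. w (c # \<tau>)) = (\<lambda>\<sigma>. t c * z c \<sigma>)"
    by metis
  have "w \<sigma> = (\<Sum>c\<in>{x\<in>X. r x = n}. t c * cone c (z c) \<sigma>)" for \<sigma>
    unfolding Q.top_chain_eq_sum_cones[OF w(1) X, of \<sigma>]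
  proof (rule sum.cong[OF refl])
    fix c assume "c \<in> {x\<in>X. r x = n}"
    then show "cone c (\<lambda>\<tau>. w (c # \<tau>)) \<sigma> = t c * cone c (z c) \<sigma>"
      using t[of c] by (cases \<sigma>) auto
  qed
  then show ?thesis by blast
qed

text \<open>Induction on the rank: the links of a top cycle are known, which makes it a combination
  of cones over \<open>J a\<close>. Its boundary vanishes, giving a relation among the
  \<open>z c\<close>, and \<open>J_relations\<close> identifies the combination as a multiple of
  \<open>z a\<close>.\<close>

lemma top_cycles_leQ:
  "a \<in> B \<Longrightarrow> w \<in> cycles leQ (W a) (r a) \<longleftrightarrow> (\<exists>t. w = (\<lambda>\<sigma>. t * z a \<sigma>))"
proof (induction "r a" arbitrary: a w)
  case (0 a)
  \<comment> \<open>Only the empty simplex remains, and it does not depend on the order.\<close>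
  then have "W a = {}" "below le B a = {}"
    using W_S[of a] below_lower[of a] by auto
  moreover have "chains leQ {} 0 = (chains le {} 0 :: ('a list \<Rightarrow> 'k) set)"
    using chains_0_cong by blast
  then have "cycles leQ {} 0 = (cycles le {} 0 :: ('a list \<Rightarrow> 'k) set)"
    by (simp add: cycles_def)
  ultimately show ?case
    using top_cycles[of a w] 0 by simp
next
  case (Suc n a)
  have cyc: "w \<in> cycles leQ (W a) (r a) \<longleftrightarrow> w \<in> chains leQ (W a) (r a) \<and> bd B w = (\<lambda>_. 0)"
    by (rule cycles_iff[OF W_sub finB]) fact
  show ?case
  proof
    assume "\<exists>t. w = (\<lambda>\<sigma>. t * z a \<sigma>)"
    then obtain t where t: "w = (\<lambda>\<sigma>. t * z a \<sigma>)" by blast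
    have "bd B w = (\<lambda>_. 0)"
      using z_cycle(2)[OF Suc.prems] by (simp add: t bd_scale fun_eq_iff)
    then show "w \<in> cycles leQ (W a) (r a)"
      unfolding cyc using z_chain_leQ[OF Suc.prems] by (auto simp: t intro: chains_scale)
  next
    assume "w \<in> cycles leQ (W a) (r a)"
    then have w: "w \<in> chains leQ (W a) (Suc n)" "bd B w = (\<lambda>_. 0)"
      using cyc Suc.hyps(2) by auto
    have "{x\<in>W a. r x < Suc n} = W a"
      using W_S[OF Suc.prems] Suc.hyps(2) by auto
    then obtain t where t: "w = (\<lambda>\<sigma>. \<Sum>c\<in>J a. t c * cone c (z c) \<sigma>)"
      using expand_in_cones[OF W_sub[OF Suc.prems], of w n] w Suc.hyps W_sub[OF Suc.prems]
        W_eq_J[OF Suc.prems, of n] by (metis subsetD)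
    have "(\<Sum>c\<in>J a. t c * z c \<sigma>) = 0" for \<sigma>
      using bd_lincomb_cone_z[of "J a" t \<sigma>] w(2) J_sub[OF Suc.prems] S_sub[OF Suc.prems]
      unfolding t by (auto simp: fun_eq_iff)
    then show "\<exists>t. w = (\<lambda>\<sigma>. t * z a \<sigma>)"
      using J_relations[OF Suc.prems, of t] unfolding t by auto
  qed
qed

section \<open>Vanishing of the lower homology\<close>

text \<open>\<open>S a\<close> and \<open>W a\<close> can differ only in the layer directly under
  \<open>a\<close> among the ranks below \<open>r a\<close>, and there \<open>J_span\<close>
  compensates.\<close>

lemma span_S_eq_span_W:
  assumes "a \<in> B" "n < r a"
  shows "\<exists>s. \<forall>\<sigma>. (\<Sum>c\<in>{c\<in>S a. r c = n}. t c * z c \<sigma>) = (\<Sum>b\<in>{b\<in>W a. r b = n}. s b * z b \<sigma>)"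
proof (cases "Suc n = r a")
  case True
  then have W: "{b\<in>W a. r b = n} = J a" using W_eq_J assms(1) by simp
  show ?thesis
    unfolding W by (rule span_trans) (use J_span[OF assms(1)] True in auto)
next
  case False
  then have "{b\<in>W a. r b = n} = {c\<in>S a. r c = n}"
    using W_S[OF assms(1)] assms(2) by (auto simp: W_def)
  then show ?thesis by auto
qed

text \<open>A cycle with \<open>n\<close> vertices per simplex in ranks below \<open>n\<close> is
  conic, so exactness in \<open>S a\<close> makes it a combination of z_b of rank \<open>n\<close>.
  If \<open>n\<close> is \<open>r a - 1\<close>, the filling may leave \<open>W a\<close>; another
  filling with the same boundary is then built from \<open>W a\<close>.\<close>

lemma conic_cycles_bound:
  fixes w :: "'a list \<Rightarrow> 'k"
  assumes a: "a \<in> B" and n: "n < r a"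
    and w: "w \<in> chains leQ {x\<in>W a. r x < n} n" "bd B w = (\<lambda>_. 0)"
  shows "\<exists>v\<in>chains leQ (W a) (Suc n). w = bd B v"
proof -
  have lower: "S a \<subseteq> B" "\<And>c. c \<in> S a \<Longrightarrow> below le B c \<subseteq> S a"
    using S_sub[OF a] S_trans[OF a] below_S by blast+
  have "w \<in> conic TYPE('k) le (S a) n"
  proof (cases n)
    case 0
    then have "w \<in> chains le (S a) 0"
      using w(1) chains_0_cong by blast
    then show ?thesis using 0 by (simp add: conic_def)
  next
    case (Suc k)
    \<comment> \<open>\<open>Suc k = n < r a\<close> puts rank \<open>k\<close> at least two below
      \<open>a\<close>, outside the layer restricted by \<open>J a\<close>.\<close>
    have "{x\<in>W a. r x = k} = {x\<in>S a. r x = k}"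
      using W_S[OF a] n Suc by (auto simp: W_def)
    moreover have "\<exists>t. w = (\<lambda>\<sigma>. \<Sum>c\<in>{x\<in>W a. r x = k}. t c * cone c (z c) \<sigma>)"
      by (rule expand_in_cones[OF W_sub[OF a]])
        (use w Suc top_cycles_leQ W_sub[OF a] in auto)
    ultimately show ?thesis
      using conic_Suc[OF lower] Suc by simp
  qed
  then obtain t where t: "\<And>\<sigma>. w \<sigma> = (\<Sum>c\<in>{c\<in>S a. r c = n}. t c * z c \<sigma>)"
    using conic_cycle_eq_lincomb[OF lower exact_S[OF a] _ w(2)] by blast
  obtain s where s: "\<And>\<sigma>. w \<sigma> = (\<Sum>b\<in>{b\<in>W a. r b = n}. s b * z b \<sigma>)"
    using span_S_eq_span_W[OF a n, of t] t by auto
  let ?v = "\<lambda>\<sigma>. \<Sum>b\<in>{b\<in>W a. r b = n}. s b * cone b (z b) \<sigma>"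
  have "w = bd B ?v"
  proof
    fix \<sigma> show "w \<sigma> = bd B ?v \<sigma>"
      unfolding s by (rule bd_lincomb_cone_z[symmetric]) (use W_sub[OF a] in auto)
  qed
  moreover have "?v \<in> chains leQ (W a) (Suc n)"
  proof (rule chains_lincomb)
    fix b assume b: "b \<in> {b\<in>W a. r b = n}"
    then have "b \<in> B" using W_sub[OF a] by auto
    then show "cone b (z b) \<in> chains leQ (W a) (Suc n)"
      using b z_chain_leQ[of b] below_leQ[of b] W_trans[OF a, of b]
      by (intro cone_chains[where T=B]) auto
  qed
  ultimately show ?thesis by blast
qed

text \<open>Cellular approximation: a cycle is pushed off its vertices of top rank by filling their links,
  until it lies in the conic complex, where exactness applies.\<close>
lemma low_cycles_bound:
  fixes w :: "'a list \<Rightarrow> 'k"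
  assumes a: "a \<in> B" and n: "n < r a"
    and links: "\<And>c k u. c \<in> W a \<Longrightarrow> k < r c \<Longrightarrow> u \<in> chains leQ (W c) k \<Longrightarrow> bd B u = (\<lambda>_. 0 :: 'k)
      \<Longrightarrow> \<exists>v\<in>chains leQ (W c) (Suc k). u = bd B v"
    and w: "w \<in> chains leQ {x\<in>W a. r x < j} n" "bd B w = (\<lambda>_. 0)"
  shows "\<exists>v\<in>chains leQ (W a) (Suc n). w = bd B v"
  using w
proof (induction j arbitrary: w)
  case 0
  from 0(1) have "w \<in> chains leQ {x\<in>W a. r x < n} n"
    by (elim chains_mono) auto
  then show ?case using conic_cycles_bound[OF a n] 0 by blast
next
  case (Suc j)
  \<comment> \<open>The first two cases are already within reach of the conic lemma. In the third,
    \<open>p < j\<close> says that the links of rank \<open>j\<close> vertices are cycles below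
    their top degree, hence fillable by \<open>links\<close>.\<close>
  consider "Suc j \<le> n" | "n = 0" | p where "n = Suc p" "p < j"
    by (cases n; cases "Suc j \<le> n") auto
  then show ?case
  proof cases
    case 1
    then have "w \<in> chains leQ {x\<in>W a. r x < n} n"
      by (intro chains_mono[OF Suc.prems(1)]) auto
    then show ?thesis using conic_cycles_bound[OF a n] Suc.prems by blast
  next
    case 2
    then have "w \<in> chains leQ {x\<in>W a. r x < n} n"
      using Suc.prems(1) chains_0_cong by blast
    then show ?thesis using conic_cycles_bound[OF a n] Suc.prems by blast
  next
    case 3
    define T where "T = {x\<in>W a. r x = j}"
    define l where "l c \<tau> = w (c # \<tau>)" for c \<tau>
    have T: "c \<in> B" "c \<in> W a" "r c = j" "W c \<subseteq> {x\<in>W a. r x < j}" if "c \<in> T" for c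
    proof -
      show c: "c \<in> W a" "r c = j" using that by (simp_all add: T_def)
      then show "c \<in> B" using W_sub[OF a] by blast
      then show "W c \<subseteq> {x\<in>W a. r x < j}"
        using W_trans[OF a c(1)] W_S[of c] c(2) by blast
    qed
    have finT: "finite T" by (rule finite_subset[OF _ finB]) (use T(1) in blast)
    have l: "l c \<in> chains leQ (W c) p" "bd B (l c) = (\<lambda>_. 0)" if c: "c \<in> T" for c
    proof -
      have "l c \<in> cycles leQ (below leQ B c) p"
        unfolding l_def[abs_def]
        by (rule Q.top_link_cycle[OF _ Suc.prems(2) W_sub[OF a] T(2,3)[OF c]])
          (use Suc.prems(1) 3 in simp)
      then show "l c \<in> chains leQ (W c) p" "bd B (l c) = (\<lambda>_. 0)"
        unfolding below_leQ[OF T(1)[OF c]] cycles_iff[OF W_sub[OF T(1)[OF c]] finB] by blast+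
    qed
    have "\<forall>c\<in>T. \<exists>v. v \<in> chains leQ (W c) n \<and> l c = bd B v"
    proof
      fix c assume c: "c \<in> T"
      have "p < r c" using T(3)[OF c] 3 by simp
      from links[OF T(2)[OF c] this l[OF c]]
      show "\<exists>v. v \<in> chains leQ (W c) n \<and> l c = bd B v" using 3 by auto
    qed
    from bchoice[OF this] obtain u where
      u: "u c \<in> chains leQ (W c) n" "bd B (u c) = l c" if "c \<in> T" for c by metis
    \<comment> \<open>Each cone over a link is exchanged for a filling \<open>u c\<close> of the
      link. Since d[c,u_c] = u_c - [c,l_c], \<open>w'\<close> is \<open>w\<close> plus the boundary
      of the sum of the [c,u_c]; this sum is subtracted again from the final filling.\<close>
    define w' where "w' = (\<lambda>\<sigma>. (w \<sigma> - (\<Sum>c\<in>T. cone c (l c) \<sigma>)) + (\<Sum>c\<in>T. u c \<sigma>))"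
    \<comment> \<open>Removing the cones leaves simplices whose first vertex is not in
      \<open>T\<close>. That vertex has the largest rank in its simplex, so all ranks are below
      \<open>j\<close>.\<close>
    have rest: "(\<lambda>\<sigma>. w \<sigma> - (\<Sum>c\<in>T. cone c (l c) \<sigma>)) \<in> chains leQ {x\<in>W a. r x < j} n"
    proof (rule chainsI)
      fix \<sigma> assume nz: "w \<sigma> - (\<Sum>c\<in>T. cone c (l c) \<sigma>) \<noteq> 0"
      have "w \<sigma> \<noteq> 0"
      proof
        assume "w \<sigma> = 0"
        moreover have "cone c (l c) \<sigma> = 0" for c
          using \<open>w \<sigma> = 0\<close> by (cases \<sigma>) (auto simp: l_def)
        ultimately show False using nz by simp
      qed
      note \<sigma> = chainsD[OF Suc.prems(1) this]
      obtain x \<tau> where x: "\<sigma> = x # \<tau>" using \<sigma>(2) 3 by (cases \<sigma>) auto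
      have "x \<notin> T"
        using nz finT by (auto simp: x l_def)
      then have "r x < j" using \<sigma>(1) by (auto simp: x simplex_def T_def less_Suc_eq)
      moreover have "r y < r x" if "y \<in> set \<tau>" for y
        using that \<sigma>(1) Q.rank_less[of y x] W_sub[OF a] by (auto simp: x simplex_def)
      ultimately show "simplex leQ {x\<in>W a. r x < j} \<sigma> \<and> length \<sigma> = n"
        using \<sigma> by (fastforce simp: x simplex_def)
    qed
    have fill: "u c \<in> chains leQ {x\<in>W a. r x < j} n" if "c \<in> T" for c
      by (rule chains_mono[OF u(1)[OF that] T(4)[OF that]])
    have w': "w' \<in> chains leQ {x\<in>W a. r x < j} n"
      unfolding w'_def by (rule chains_add[OF rest chains_sum[OF fill]])
    have cone_l: "bd B (cone c (l c)) \<sigma> = l c \<sigma>" if "c \<in> T" for c \<sigma>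
    proof -
      have "cone c (\<lambda>_. 0 :: 'k) \<sigma> = 0" by (cases \<sigma>) auto
      then show ?thesis
        using bd_cone[OF finB T(1)[OF that], of "l c" \<sigma>] l(2)[OF that] by simp
    qed
    have "bd B w' \<sigma> = 0" for \<sigma>
      unfolding w'_def bd_add bd_diff bd_sum
      using Suc.prems(2) cone_l u(2) by simp
    then have "bd B w' = (\<lambda>_. 0)" by blast
    then obtain v where v: "v \<in> chains leQ (W a) (Suc n)" "w' = bd B v"
      using Suc.IH[OF w'] by blast
    let ?v = "\<lambda>\<sigma>. v \<sigma> - (\<Sum>c\<in>T. cone c (u c) \<sigma>)"
    have "bd B ?v \<sigma> = w \<sigma>" for \<sigma>
    proof -
      have "bd B ?v \<sigma> = w' \<sigma> - (\<Sum>c\<in>T. u c \<sigma> - cone c (l c) \<sigma>)"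
        unfolding bd_diff bd_sum v(2) by (simp add: bd_cone[OF finB T(1)] u(2) cong: sum.cong)
      then show ?thesis by (simp add: w'_def sum_subtractf)
    qed
    moreover have "?v \<in> chains leQ (W a) (Suc n)"
    proof (rule chains_diff[OF v(1) chains_sum])
      fix c assume c: "c \<in> T"
      then show "cone c (u c) \<in> chains leQ (W a) (Suc n)"
        using u(1)[OF c] T[OF c] below_leQ[of c] by (intro cone_chains[where T=B]) auto
    qed
    ultimately show ?thesis by (intro bexI[of _ ?v]) auto
  qed
qed

text \<open>Well-founded induction on \<open>r a\<close> supplies the fillings of links; the bound
  \<open>j = r a\<close> then admits every vertex of \<open>W a\<close>.\<close>

lemma cycles_bound:
  "a \<in> B \<Longrightarrow> n < r a \<Longrightarrow> w \<in> chains leQ (W a) n \<Longrightarrow> bd B w = (\<lambda>_. 0 :: 'k)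
    \<Longrightarrow> \<exists>v\<in>chains leQ (W a) (Suc n). w = bd B v"
proof (induction "r a" arbitrary: a n w rule: less_induct)
  case less
  have W: "{x\<in>W a. r x < r a} = W a" using W_S[OF less.prems(1)] by auto
  show ?case
  proof (rule low_cycles_bound[OF less.prems(1,2)])
    show "w \<in> chains leQ {x\<in>W a. r x < r a} n" unfolding W by (rule less.prems(3))
    show "bd B w = (\<lambda>_. 0)" by (rule less.prems(4))
    fix c k and u :: "'a list \<Rightarrow> 'k"
    assume c: "c \<in> W a" "k < r c" "u \<in> chains leQ (W c) k" "bd B u = (\<lambda>_. 0)"
    have "r c < r a" "c \<in> B" using W_S W_sub less.prems(1) c(1) by auto
    then show "\<exists>v\<in>chains leQ (W c) (Suc k). u = bd B v"
      using less.hyps c(2-4) by blast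
  qed
qed

section \<open>Dimensions, the hcw property and the conic complex of the new order\<close>

lemma ocdim_eqI:
  assumes "T \<subseteq> B" "\<And>x. x \<in> T \<Longrightarrow> r x < n" "simplex leQ T \<sigma>" "length \<sigma> = n"
  shows "ocdim leQ T = int n - 1"
proof -
  have "Max (length ` {\<sigma>. simplex leQ T \<sigma>}) = n"
  proof (rule Max_eqI)
    have "length ` {\<sigma>. simplex leQ T \<sigma>} \<subseteq> {..n}"
      using Q.simplex_length_le assms(1,2) by auto
    then show "finite (length ` {\<sigma>. simplex leQ T \<sigma>})" by (rule finite_subset) simp
  qed (use Q.simplex_length_le assms in auto)
  then show ?thesis by (simp add: ocdim_def)
qed

lemma max_simplex:
  assumes a: "a \<in> B"
  obtains \<sigma> where "simplex le (below_eq le B a) \<sigma>" "length \<sigma> = Suc (r a)"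
proof -
  have "length ` {\<sigma>. simplex le (below_eq le B a) \<sigma>} \<subseteq> {..Suc (r a)}"
  proof -
    have "r x < Suc (r a)" if "x \<in> below_eq le B a" for x
      using that rank_less[of x a] a by (auto simp: below_eq_def lt_of_def less_Suc_eq)
    then show ?thesis
      using simplex_length_le[of "below_eq le B a" _ "Suc (r a)"] by (auto simp: below_eq_def)
  qed
  then have "finite (length ` {\<sigma>. simplex le (below_eq le B a) \<sigma>})"
    by (rule finite_subset) simp
  moreover have "simplex le (below_eq le B a) []" by (simp add: simplex_def)
  ultimately have "Max (length ` {\<sigma>. simplex le (below_eq le B a) \<sigma>})
      \<in> length ` {\<sigma>. simplex le (below_eq le B a) \<sigma>}"
    by (intro Max_in) auto
  moreover have "Max (length ` {\<sigma>. simplex le (below_eq le B a) \<sigma>}) = Suc (r a)"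
    using rank[OF a] by (simp add: ocdim_def)
  ultimately show ?thesis using that by auto
qed

lemma simplex_le_leQ: "simplex le T \<sigma> \<Longrightarrow> T \<subseteq> B \<Longrightarrow> T \<subseteq> T' \<Longrightarrow> simplex leQ T' \<sigma>"
  by (erule simplex_mono) (auto intro: le_leQ)

text \<open>Old chains remain chains, so dimensions cannot drop; \<open>r\<close> is still strictly
  increasing for \<open>leQ\<close>, so they cannot grow.\<close>

lemma ocdim_leQ:
  assumes a: "a \<in> B"
  shows "ocdim leQ (below_eq leQ B a) = int (r a)" "ocdim leQ (W a) = int (r a) - 1"
proof -
  obtain \<sigma> where \<sigma>: "simplex le (below_eq le B a) \<sigma>" "length \<sigma> = Suc (r a)"
    by (rule max_simplex[OF a])
  have "simplex leQ (below_eq leQ B a) \<sigma>"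
    by (rule simplex_le_leQ[OF \<sigma>(1)]) (use le_leQ a in \<open>auto simp: below_eq_def\<close>)
  moreover have "r x < Suc (r a)" if "x \<in> below_eq leQ B a" for x
    using that Q.rank_less[of x a] a by (auto simp: below_eq_def lt_of_def less_Suc_eq)
  ultimately show "ocdim leQ (below_eq leQ B a) = int (r a)"
    using ocdim_eqI[of "below_eq leQ B a" "Suc (r a)" \<sigma>] \<sigma>(2) by (auto simp: below_eq_def)
  obtain x \<tau> where x: "\<sigma> = x # \<tau>" using \<sigma>(2) by (cases \<sigma>) auto
  \<comment> \<open>Dropping the head of a longest chain below or equal to \<open>a\<close> leaves
    \<open>r a\<close> elements strictly below \<open>a\<close>.\<close>
  have "y \<in> below le B a" if "y \<in> set \<tau>" for y
  proof -
    have "lt_of le y x" "y \<in> B" "x \<in> B" "le x a"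
      using that \<sigma>(1) by (auto simp: x simplex_def below_eq_def)
    then show ?thesis
      using poset a unfolding below_def lt_of_def poset_on_def by blast
  qed
  then have "simplex le (below le B a) \<tau>"
    using \<sigma>(1) by (auto simp: x simplex_def)
  then have "simplex leQ (W a) \<tau>"
    by (rule simplex_le_leQ) (use below_W[OF a] in \<open>auto simp: below_def\<close>)
  then show "ocdim leQ (W a) = int (r a) - 1"
    using ocdim_eqI[of "W a" "r a" \<tau>] W_S[OF a] W_sub[OF a] \<sigma>(2) by (simp add: x)
qed

text \<open>In index \<open>r a\<close> there are no nonzero boundaries, so the nonzero cycle
  \<open>z a\<close> generates the homology. Smaller indices are handled by
  \<open>cycles_bound\<close>, and for larger ones there are no nonzero chains.\<close>

lemma hcw_leQ:
  assumes z_nonzero: "\<And>a. a \<in> B \<Longrightarrow> z a \<noteq> (\<lambda>_. 0)"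
  shows "hcw TYPE('k) leQ B"
  unfolding hcw_def
proof (intro conjI ballI allI impI)
  show "poset_on B leQ" by (rule Q.poset)
next
  fix a and n :: nat
  assume a: "a \<in> B" and "int n - 1 = ocdim leQ (below leQ B a)"
  then have n: "n = r a" using ocdim_leQ[OF a] below_leQ[OF a] by simp
  have "z a \<notin> boundaries leQ (W a) (r a)"
  proof
    assume "z a \<in> boundaries leQ (W a) (r a)"
    then have "z a = (\<lambda>_. 0)"
      by (rule Q.boundaries_above_rank[OF _ W_sub[OF a]]) (use W_S[OF a] in simp)
    then show False using z_nonzero[OF a] by simp
  qed
  moreover have "z a \<in> cycles leQ (W a) (r a)"
    using top_cycles_leQ[OF a, of "z a"] by (metis mult_1)
  moreover have "\<exists>t. (\<lambda>\<sigma>. w \<sigma> - t * z a \<sigma>) \<in> boundaries leQ (W a) (r a)"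
    if w: "w \<in> cycles leQ (W a) (r a)" for w
  proof -
    obtain t where "w = (\<lambda>\<sigma>. t * z a \<sigma>)" using w top_cycles_leQ[OF a] by blast
    then show ?thesis using zero_boundaries by (intro exI[of _ t]) simp
  qed
  ultimately show "hom_is_field TYPE('k) leQ (below leQ B a) n"
    unfolding hom_is_field_def below_leQ[OF a] n by (intro bexI[of _ "z a"] conjI ballI)
next
  fix a and n :: nat
  assume a: "a \<in> B" and "int n - 1 \<noteq> ocdim leQ (below leQ B a)"
  then have n: "n < r a \<or> r a < n" using ocdim_leQ[OF a] below_leQ[OF a] by auto
  have "w \<in> boundaries leQ (W a) n" if "w \<in> cycles leQ (W a) n" for w :: "'a list \<Rightarrow> 'k"
  proof -
    have w: "w \<in> chains leQ (W a) n" "bd B w = (\<lambda>_. 0)"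
      using that cycles_iff[OF W_sub[OF a] finB] by blast+
    have "\<exists>v\<in>chains leQ (W a) (Suc n). w = bd B v"
      using n
    proof
      assume "r a < n"
      then have "w = bd B (\<lambda>_. 0)"
        using Q.chains_above_rank[OF w(1) W_sub[OF a], of "r a"] W_S[OF a] by (simp add: bd_zero)
      then show ?thesis using chains_zero by blast
    qed (use cycles_bound[OF a] w in blast)
    then show ?thesis using boundaries_iff[OF W_sub[OF a] finB] by blast
  qed
  then show "hom_vanishes TYPE('k) leQ (below leQ B a) n"
    unfolding hom_vanishes_def below_leQ[OF a] by blast
qed

text \<open>Ranks and top cycles are the same for both orders, so even the generating sets
  coincide.\<close>

lemma conic_leQ: "conic TYPE('k) leQ B L = conic TYPE('k) le B L"
proof (cases L)
  case 0
  have "chains leQ B 0 = (chains le B 0 :: ('a list \<Rightarrow> 'k) set)"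
    using chains_0_cong by blast
  then show ?thesis using 0 by (simp add: conic_def)
next
  case (Suc n)
  have "c \<in> B \<and> ocdim leQ (below_eq leQ B c) = int L - 1 \<and> u \<in> cycles leQ (below leQ B c) (L - 1)
    \<longleftrightarrow> c \<in> B \<and> ocdim le (below_eq le B c) = int L - 1 \<and> u \<in> cycles le (below le B c) (L - 1)"
    for c and u :: "'a list \<Rightarrow> 'k"
    using ocdim_leQ(1)[of c] rank[of c] top_cycles_leQ[of c u] top_cycles[of c u] below_leQ[of c] Suc
    by auto
  then show ?thesis unfolding conic_def using Suc by simp
qed

end

section \<open>The rank given by d_P and the instantiation\<close>

lemma finite_simplex_lengths:
  assumes "finite B" "S \<subseteq> B"
  shows "finite (length ` {\<sigma>. simplex le S \<sigma>})"
proof -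
  have "length \<sigma> \<le> card B" if "simplex le S \<sigma>" for \<sigma>
  proof -
    have "sorted_wrt (\<noteq>) \<sigma>"
      by (rule sorted_wrt_mono_rel[of _ "\<lambda>x y. lt_of le y x"])
        (use that in \<open>auto simp: simplex_def lt_of_def\<close>)
    then have "distinct \<sigma>" by (induction \<sigma>) auto
    moreover have "set \<sigma> \<subseteq> B" using that assms(2) by (auto simp: simplex_def)
    ultimately show ?thesis using assms(1) card_mono distinct_card by metis
  qed
  then have "length ` {\<sigma>. simplex le S \<sigma>} \<subseteq> {..card B}" by auto
  then show ?thesis by (rule finite_subset) simp
qed

text \<open>The one-vertex chain at \<open>x\<close> exists, so passing from the integer dimension
  to a natural number rank loses nothing.\<close>

lemma ocdim_nonneg:
  assumes "finite B" "poset_on B le" "x \<in> B"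
  shows "0 \<le> ocdim le (below_eq le B x)"
proof -
  let ?L = "length ` {\<sigma>. simplex le (below_eq le B x) \<sigma>}"
  have "simplex le (below_eq le B x) [x]"
    using assms(2,3) by (auto simp: simplex_def below_eq_def poset_on_def)
  then have "1 \<in> ?L" by force
  moreover have "finite ?L"
    by (rule finite_simplex_lengths[OF assms(1)]) (auto simp: below_eq_def)
  ultimately have "1 \<le> Max ?L" by (intro Max_ge)
  then show ?thesis unfolding ocdim_def by linarith
qed

text \<open>A longest chain ending at or below \<open>x\<close> can be prolonged by \<open>y\<close>
  on top.\<close>

lemma ocdim_less:
  assumes "finite B" "poset_on B le" "x \<in> B" "y \<in> B" "lt_of le x y"
  shows "ocdim le (below_eq le B x) < ocdim le (below_eq le B y)"
proof -
  let ?L = "\<lambda>a. length ` {\<sigma>. simplex le (below_eq le B a) \<sigma>}"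
  have fin: "finite (?L a)" for a
    by (rule finite_simplex_lengths[OF assms(1)]) (auto simp: below_eq_def)
  have "simplex le (below_eq le B x) []" by (simp add: simplex_def)
  then have "Max (?L x) \<in> ?L x" using fin by (intro Max_in) auto
  then obtain \<sigma> where \<sigma>: "simplex le (below_eq le B x) \<sigma>" "length \<sigma> = Max (?L x)" by auto
  have "lt_of le v y \<and> v \<in> B" if "v \<in> set \<sigma>" for v
    using that \<sigma>(1) assms(2-5) unfolding simplex_def below_eq_def lt_of_def poset_on_def by blast
  then have "simplex le (below_eq le B y) (y # \<sigma>)"
    using \<sigma>(1) assms(2,4) by (auto simp: simplex_def below_eq_def lt_of_def poset_on_def)
  then have "Suc (Max (?L x)) \<in> ?L y" using \<sigma>(2) by force
  then have "Suc (Max (?L x)) \<le> Max (?L y)" by (intro Max_ge fin)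
  then show ?thesis unfolding ocdim_def by linarith
qed

theorem mainTheorem11:
  fixes B :: "'a set" and m :: nat and deg :: "'a \<Rightarrow> nat \<Rightarrow> int"
    and leP :: "'a \<Rightarrow> 'a \<Rightarrow> bool"
  assumes "finite B"
    and "poset_on B leP"
    and "deg_mono m deg leP B"
    and "\<forall>a\<in>B. hom_is_field TYPE('k::field) leP (below leP B a)
                 (nat (ocdim leP (below_eq leP B a)))"
    and "\<forall>\<alpha>. deg_sub m deg B \<alpha> \<noteq> {} \<longrightarrow> exact_conic TYPE('k) leP (deg_sub m deg B \<alpha>)"
  shows "\<exists>leQ. hcw TYPE('k) leQ B
           \<and> (\<forall>x\<in>B. \<forall>y\<in>B. leP x y \<longrightarrow> leQ x y)
           \<and> deg_mono m deg leQ B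
           \<and> (\<forall>a\<in>B. ocdim leP (below_eq leP B a) = ocdim leQ (below_eq leQ B a))
           \<and> (\<forall>L. conic TYPE('k) leP B L = conic TYPE('k) leQ B L)"
proof -
  define r where "r a = nat (ocdim leP (below_eq leP B a))" for a
  \<comment> \<open>\<open>S a\<close> contains \<open>a\<close>, so the exactness hypothesis
    applies to it, and placing only elements of \<open>S a\<close> below \<open>a\<close> keeps deg
    monotone.\<close>
  define S where "S a = deg_sub m deg B (deg a)" for a
  have rank: "ocdim leP (below_eq leP B a) = int (r a)" if "a \<in> B" for a
    using ocdim_nonneg[OF assms(1,2) that] by (simp add: r_def)
  interpret P: ranked_poset B leP r
  proof
    show "r x < r y" if "x \<in> B" "y \<in> B" "lt_of leP x y" for x y
      using ocdim_less[OF assms(1,2) that] rank that by simp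
  qed (fact assms)+
  have below_B: "below leP B a \<subseteq> B" for a by (auto simp: below_def)
  have top_boundaries: "u = (\<lambda>_. 0)"
    if a: "a \<in> B" and u: "u \<in> boundaries leP (below leP B a) (r a)" for a and u :: "'a list \<Rightarrow> 'k"
    by (rule P.boundaries_above_rank[OF u below_B]) (use P.below_lower[OF a] in auto)
  have "\<exists>u::'a list \<Rightarrow> 'k. u \<noteq> (\<lambda>_. 0)
      \<and> (\<forall>w. w \<in> cycles leP (below leP B a) (r a) \<longleftrightarrow> (\<exists>t. w = (\<lambda>\<sigma>. t * u \<sigma>)))"
    if a: "a \<in> B" for a
  proof -
    obtain u :: "'a list \<Rightarrow> 'k" where u: "u \<in> cycles leP (below leP B a) (r a)"
      "u \<notin> boundaries leP (below leP B a) (r a)"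
      and gen: "\<And>w. w \<in> cycles leP (below leP B a) (r a)
        \<Longrightarrow> \<exists>t. (\<lambda>\<sigma>. w \<sigma> - t * u \<sigma>) \<in> boundaries leP (below leP B a) (r a)"
      using assms(4) a unfolding hom_is_field_def r_def by blast
    have "u \<noteq> (\<lambda>_. 0)" using u(2) zero_boundaries by blast
    moreover have "\<exists>t. w = (\<lambda>\<sigma>. t * u \<sigma>)" if w: "w \<in> cycles leP (below leP B a) (r a)" for w
    proof -
      obtain t where "(\<lambda>\<sigma>. w \<sigma> - t * u \<sigma>) \<in> boundaries leP (below leP B a) (r a)"
        using gen[OF w] by blast
      from top_boundaries[OF a this] have "w = (\<lambda>\<sigma>. t * u \<sigma>)"
        by (simp add: fun_eq_iff)
      then show ?thesis by blast
    qed
    moreover have "(\<lambda>\<sigma>. t * u \<sigma>) \<in> cycles leP (below leP B a) (r a)" for t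
      using u(1) unfolding cycles_iff[OF below_B assms(1)]
      by (simp add: chains_scale bd_scale fun_eq_iff)
    ultimately show ?thesis by blast
  qed
  then obtain z :: "'a \<Rightarrow> 'a list \<Rightarrow> 'k" where z: "\<And>a. a \<in> B \<Longrightarrow> z a \<noteq> (\<lambda>_. 0)"
    and top: "\<And>a w. a \<in> B
      \<Longrightarrow> w \<in> cycles leP (below leP B a) (r a) \<longleftrightarrow> (\<exists>t. w = (\<lambda>\<sigma>. t * z a \<sigma>))"
    by metis
  interpret P: cyclic_poset B leP r z
    by unfold_locales (fact rank top)+
  have S_sub: "S a \<subseteq> B" for a
    by (auto simp: S_def deg_sub_def)
  have below_S: "below leP B a \<subseteq> S a" if "a \<in> B" for a
    using that assms(3) by (auto simp: S_def deg_sub_def below_def lt_of_def deg_mono_def)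
  have ex_J: "\<exists>J. {c\<in>below leP B a. Suc (r c) = r a} \<subseteq> J \<and> J \<subseteq> {c\<in>S a. Suc (r c) = r a}
      \<and> (\<forall>t. (\<forall>\<sigma>. (\<Sum>c\<in>J. t c * z c \<sigma>) = 0)
          \<longrightarrow> (\<exists>s. \<forall>\<sigma>. (\<Sum>c\<in>J. t c * cone c (z c) \<sigma>) = s * z a \<sigma>))
      \<and> (\<forall>c\<in>{c\<in>S a. Suc (r c) = r a}. \<exists>s. \<forall>\<sigma>. z c \<sigma> = (\<Sum>b\<in>J. s b * z b \<sigma>))"
    if a: "a \<in> B" for a
  proof (rule extend_with_controlled_relations)
    show "finite {c\<in>S a. Suc (r c) = r a}"
      by (rule finite_subset[OF _ assms(1)]) (use S_sub in auto)
    show "{c\<in>below leP B a. Suc (r c) = r a} \<subseteq> {c\<in>S a. Suc (r c) = r a}"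
      using below_S[OF a] by blast
    \<comment> \<open>The starting set is admissible: a relation among its \<open>z c\<close> turns
      the combination of cones into a top cycle of P_{<a}, which is a multiple of \<open>z a\<close>
      by the homology hypothesis.\<close>
    show "\<forall>t. (\<forall>\<sigma>. (\<Sum>c\<in>{c\<in>below leP B a. Suc (r c) = r a}. t c * z c \<sigma>) = 0)
      \<longrightarrow> (\<exists>s. \<forall>\<sigma>. (\<Sum>c\<in>{c\<in>below leP B a. Suc (r c) = r a}. t c * cone c (z c) \<sigma>) = s * z a \<sigma>)"
      (is "\<forall>t. (\<forall>\<sigma>. (\<Sum>c\<in>?I. _ c \<sigma>) = 0) \<longrightarrow> _")
    proof (intro allI impI)
      fix t :: "'a \<Rightarrow> 'k" assume t: "\<forall>\<sigma>. (\<Sum>c\<in>?I. t c * z c \<sigma>) = 0"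
      let ?w = "\<lambda>\<sigma>. \<Sum>c\<in>?I. t c * cone c (z c) \<sigma>"
      have I: "c \<in> B" "c \<in> below leP B a" "Suc (r c) = r a" if "c \<in> ?I" for c
        using that below_B by auto
      have "?w \<in> chains leP (below leP B a) (r a)"
      proof (rule chains_lincomb)
        fix c assume "c \<in> ?I"
        from I[OF this] show "cone c (z c) \<in> chains leP (below leP B a) (r a)"
          using cone_chains[OF P.z_cycle(1)[of c], of "below leP B a"] P.below_trans[OF a] by simp
      qed
      moreover have "bd B ?w = (\<lambda>_. 0)"
      proof
        fix \<sigma> show "bd B ?w \<sigma> = 0"
          using P.bd_lincomb_cone_z[of ?I t \<sigma>] t I(1) by auto
      qed
      ultimately have "?w \<in> cycles leP (below leP B a) (r a)"
        using cycles_iff[OF below_B assms(1)] by blast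
      then show "\<exists>s. \<forall>\<sigma>. ?w \<sigma> = s * z a \<sigma>"
        using top[OF a, of ?w] by (auto simp: fun_eq_iff)
    qed
  qed
  obtain J where J: "\<forall>a\<in>B. {c\<in>below leP B a. Suc (r c) = r a} \<subseteq> J a
      \<and> J a \<subseteq> {c\<in>S a. Suc (r c) = r a}
      \<and> (\<forall>t. (\<forall>\<sigma>. (\<Sum>c\<in>J a. t c * z c \<sigma>) = 0)
          \<longrightarrow> (\<exists>s. \<forall>\<sigma>. (\<Sum>c\<in>J a. t c * cone c (z c) \<sigma>) = s * z a \<sigma>))
      \<and> (\<forall>c\<in>{c\<in>S a. Suc (r c) = r a}. \<exists>s. \<forall>\<sigma>. z c \<sigma> = (\<Sum>b\<in>J a. s b * z b \<sigma>))"
    using bchoice[OF ballI[OF ex_J]] by (rule exE)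
  interpret Q: thickening B leP r z S J
  proof
    show "S b \<subseteq> S a" if "a \<in> B" "b \<in> S a" for a b
      using that by (force simp: S_def deg_sub_def)
    show "exact_conic TYPE('k) leP (S a)" if "a \<in> B" for a
    proof -
      have "a \<in> S a" using that by (simp add: S_def deg_sub_def)
      then show ?thesis using assms(5) unfolding S_def by blast
    qed
    show "\<exists>s. \<forall>\<sigma>. z c \<sigma> = (\<Sum>b\<in>J a. s b * z b \<sigma>)"
      if "a \<in> B" "c \<in> S a" "Suc (r c) = r a" for a c
      using bspec[OF J that(1)] that(2,3) by simp
    show "\<exists>s. \<forall>\<sigma>. (\<Sum>c\<in>J a. t c * cone c (z c) \<sigma>) = s * z a \<sigma>"
      if "a \<in> B" "\<forall>\<sigma>. (\<Sum>c\<in>J a. t c * z c \<sigma>) = 0" for a t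
      using bspec[OF J that(1)] that(2) by blast
    show "{c\<in>below leP B a. Suc (r c) = r a} \<subseteq> J a" "J a \<subseteq> {c\<in>S a. Suc (r c) = r a}"
      if "a \<in> B" for a
      using bspec[OF J that] by blast+
  qed (use S_sub below_S in blast)+
  have "deg_mono m deg Q.leQ B"
    unfolding deg_mono_def
  proof (intro ballI impI)
    fix x y assume "y \<in> B" "Q.leQ x y"
    then have "x = y \<or> x \<in> S y" using Q.W_S by (auto simp: Q.leQ_def)
    then show "\<forall>i<m. deg x i \<le> deg y i" by (auto simp: S_def deg_sub_def)
  qed
  then show ?thesis
    using Q.hcw_leQ[OF z] Q.le_leQ Q.ocdim_leQ(1) Q.conic_leQ rank
    by (intro exI[of _ Q.leQ]) auto
qed

end
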